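(* For every integer $k \geq 2$ there exists a connected graph $G_k$ with exactly $15k$ vertices such that $z(G_k) \geq k$, i.e. for every placement of at most $k-1$ zombies on $G_k$ the survivor has a strategy to avoid capture forever.
   Context: All graphs are finite, simple and undirected. The (deterministic) zombies-and-survivor game on a connected graph $G$: in round $0$ the zombies choose starting vertices (several zombies may share a vertex), then the survivor chooses a starting vertex. In each subsequent round, first every zombie must move from its current vertex $u$ to a neighbour $w$ of $u$ that lies on a shortest path in $G$ from $u$ to the survivor's current vertex (if several such $w$ exist, the zombies choose); then the survivor either stays put or moves to an adjacent vertex. Both sides have full information. The zombies win if at some moment a zombie occupies the survivor's vertex; the survivor wins if this never happens. The zombie number $z(G)$ is the minimum number of zombies for which the zombies (choosing their starting positions) have a winning strategy. *)

theory Defs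
  imports "Graph_Theory.Digraph_Component" "Graph_Theory.Vertex_Walk"
begin

text \<open>
  Finite simple undirected graphs are the structures satisfying \<open>pair_graph\<close>: every edge is
  represented by its two orientations in \<open>parcs G\<close>.
\<close>

definition shortest_path :: "'a pair_pre_digraph \<Rightarrow> 'a \<Rightarrow> 'a list \<Rightarrow> 'a \<Rightarrow> bool" where
  "shortest_path G u p v \<longleftrightarrow>
     vpath p (with_proj G) \<and> hd p = u \<and> last p = v \<and>
     (\<forall>q. vpath q (with_proj G) \<and> hd q = u \<and> last q = v \<longrightarrow> vwalk_length p \<le> vwalk_length q)"

definition zombie_move :: "'a pair_pre_digraph \<Rightarrow> 'a \<Rightarrow> 'a \<Rightarrow> 'a \<Rightarrow> bool" where
  "zombie_move G s u w \<longleftrightarrow> (u, w) \<in> parcs G \<and> (\<exists>p. shortest_path G u p s \<and> w \<in> set p)"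

definition survivor_move :: "'a pair_pre_digraph \<Rightarrow> 'a \<Rightarrow> 'a \<Rightarrow> bool" where
  "survivor_move G s s' \<longleftrightarrow> s' = s \<or> (s, s') \<in> parcs G"

text \<open>
  A history lists the completed rounds, oldest first, round 0 being the choice of the starting
  vertices. A completed round is recorded as the positions of the zombies (the list index
  identifies the zombie) and of the survivor at its end.
\<close>

type_synonym 'a history = "('a list \<times> 'a) list"

definition legal_zombies :: "'a pair_pre_digraph \<Rightarrow> nat \<Rightarrow> 'a history \<Rightarrow> 'a list \<Rightarrow> bool" where
  "legal_zombies G m h Z \<longleftrightarrow>
     (if h = [] then length Z = m \<and> set Z \<subseteq> pverts G
      else list_all2 (zombie_move G (snd (last h))) (fst (last h)) Z)"

definition legal_survivor :: "'a pair_pre_digraph \<Rightarrow> 'a history \<Rightarrow> 'a \<Rightarrow> bool" where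
  "legal_survivor G h s \<longleftrightarrow>
     (if h = [] then s \<in> pverts G else survivor_move G (snd (last h)) s)"

definition caught_by_zombies :: "'a history \<Rightarrow> 'a list \<Rightarrow> bool" where
  "caught_by_zombies h Z \<longleftrightarrow> h \<noteq> [] \<and> snd (last h) \<in> set Z"

text \<open>
  The game stops at a capture (a zombie on the survivor's vertex has no legal move), so the
  histories at which it is still running are those along which all moves were legal and no
  capture occurred, neither by a move of the zombies nor by one of the survivor.
\<close>

inductive ongoing :: "'a pair_pre_digraph \<Rightarrow> nat \<Rightarrow> 'a history \<Rightarrow> bool"
  for G :: "'a pair_pre_digraph" and m :: nat where
  start: "ongoing G m []"
| round: "\<lbrakk>ongoing G m h; legal_zombies G m h Z; \<not> caught_by_zombies h Z;
           legal_survivor G h s; s \<notin> set Z\<rbrakk> \<Longrightarrow> ongoing G m (h @ [(Z, s)])"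

text \<open>
  Strategies may depend on the whole history; the survivor moves second in each round, and thus
  also sees the zombies' positions in the current round.
\<close>

type_synonym 'a zombie_strategy = "'a history \<Rightarrow> 'a list"
type_synonym 'a survivor_strategy = "'a history \<Rightarrow> 'a list \<Rightarrow> 'a"

definition follows_zombies :: "'a zombie_strategy \<Rightarrow> 'a history \<Rightarrow> bool" where
  "follows_zombies \<sigma> h \<longleftrightarrow> (\<forall>n < length h. fst (h ! n) = \<sigma> (take n h))"

definition follows_survivor :: "'a survivor_strategy \<Rightarrow> 'a history \<Rightarrow> bool" where
  "follows_survivor \<tau> h \<longleftrightarrow> (\<forall>n < length h. snd (h ! n) = \<tau> (take n h) (fst (h ! n)))"

text \<open>
  Since the survivor always has a legal move, a play in which the zombies follow a strategy making
  only legal moves either reaches a capture or runs forever; the latter must be impossible.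
\<close>

definition zombie_winning_strategy ::
    "'a pair_pre_digraph \<Rightarrow> nat \<Rightarrow> 'a zombie_strategy \<Rightarrow> bool" where
  "zombie_winning_strategy G m \<sigma> \<longleftrightarrow>
     (\<forall>h. ongoing G m h \<and> follows_zombies \<sigma> h \<longrightarrow> legal_zombies G m h (\<sigma> h)) \<and>
     \<not> (\<exists>r :: nat \<Rightarrow> 'a list \<times> 'a. \<forall>n.
          ongoing G m (map r [0..<n]) \<and> follows_zombies \<sigma> (map r [0..<n]))"

text \<open>
  \<open>Z\<^sub>0\<close> is the zombies' starting placement; the survivor's starting vertex is \<open>\<tau> [] Z\<^sub>0\<close>.
\<close>

definition survivor_winning_strategy ::
    "'a pair_pre_digraph \<Rightarrow> 'a list \<Rightarrow> 'a survivor_strategy \<Rightarrow> bool" where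
  "survivor_winning_strategy G Z\<^sub>0 \<tau> \<longleftrightarrow>
     (\<forall>h Z. ongoing G (length Z\<^sub>0) h \<and> follows_survivor \<tau> h \<and> (h \<noteq> [] \<longrightarrow> fst (hd h) = Z\<^sub>0) \<and>
        legal_zombies G (length Z\<^sub>0) h Z \<and> (h = [] \<longrightarrow> Z = Z\<^sub>0) \<longrightarrow>
        \<not> caught_by_zombies h Z \<and> legal_survivor G h (\<tau> h Z) \<and> \<tau> h Z \<notin> set Z)"

definition zombie_number :: "'a pair_pre_digraph \<Rightarrow> nat" where
  "zombie_number G = (LEAST m. \<exists>\<sigma>. zombie_winning_strategy G m \<sigma>)"

text \<open>The minimum exists: one zombie on every vertex leaves the survivor no starting vertex.\<close>

lemma zombie_winning_strategy_card:
  assumes "finite (pverts G)"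
  shows "\<exists>\<sigma>. zombie_winning_strategy G (card (pverts G)) \<sigma>"
proof -
  obtain V where V: "set V = pverts G" "distinct V"
    using finite_distinct_list[OF assms] by blast
  have len: "length V = card (pverts G)"
    using V distinct_card by metis
  have first: "fst (h ! 0) = V \<and> snd (h ! 0) \<in> pverts G \<and> snd (h ! 0) \<notin> set (fst (h ! 0))"
    if "ongoing G m h" "h \<noteq> []" "follows_zombies (\<lambda>_. V) h" for h m
  proof -
    have "snd (h ! 0) \<in> pverts G \<and> snd (h ! 0) \<notin> set (fst (h ! 0))"
      using that(1,2)
    proof (induction rule: ongoing.induct)
      case start
      then show ?case by simp
    next
      case (round h Z s)
      then show ?case
        by (cases "h = []") (auto simp: legal_survivor_def nth_append)
    qed
    then show ?thesis
      using that(2,3) by (auto simp: follows_zombies_def)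
  qed
  have nil: "h = []" if "ongoing G m h" "follows_zombies (\<lambda>_. V) h" for h m
    using first[OF that(1) _ that(2)] V by auto
  have "zombie_winning_strategy G (card (pverts G)) (\<lambda>_. V)"
    unfolding zombie_winning_strategy_def
  proof (intro conjI allI impI notI)
    fix h assume "ongoing G (card (pverts G)) h \<and> follows_zombies (\<lambda>_. V) h"
    then have "h = []" using nil by blast
    then show "legal_zombies G (card (pverts G)) h V"
      using V len by (simp add: legal_zombies_def)
  next
    assume "\<exists>r. \<forall>n. ongoing G (card (pverts G)) (map r [0..<n]) \<and>
              follows_zombies (\<lambda>_. V) (map r [0..<n])"
    then obtain r where "ongoing G (card (pverts G)) (map r [0..<1])"
        "follows_zombies (\<lambda>_. V) (map r [0..<1])" by blast
    then show False using nil by fastforce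
  qed
  then show ?thesis by blast
qed

end

theory Submission
  imports Defs
begin

text \<open>
  Take \<open>k\<close> copies of the Petersen graph, choose a root in each of them, and make the \<open>k\<close> roots and
  \<open>5 * k\<close> further vertices into a clique. Some copy contains none of the at most \<open>k - 1\<close> zombies,
  and the survivor stays in it. Every zombie enters through the root, in one of the rounds 1, 2, 3
  (the eccentricity of a root in its copy is 2). Geodesics of the Petersen graph are unique, so
  zombies entering in the same round move identically and the number of zombies is irrelevant: one
  fixed walk of the survivor beats all of them. After five rounds of it all zombies stand on one
  vertex, two steps behind the survivor, who then runs around a 5-cycle forever.
\<close>

section \<open>Survivors that ignore the zombies\<close>

text \<open>Each arc lowers \<open>f\<close> by at most 1, so a drop in \<open>f\<close> bounds the
  number \<open>length p - 1\<close> of arcs from below.\<close>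

lemma vwalk_potential_le:
  fixes f :: "'a \<Rightarrow> nat"
  assumes "vwalk p (with_proj G)"
    and lip: "\<And>u v. (u, v) \<in> parcs G \<Longrightarrow> f u \<le> f v + 1"
  shows "f (hd p) \<le> f (last p) + (length p - 1)"
  using assms(1)
proof (induction rule: vwalk_induct)
  case (Base u)
  then show ?case by simp
next
  case (Cons u v es)
  then have "f u \<le> f v + 1" using lip by simp
  with Cons show ?case by simp
qed

text \<open>Following descending arcs reaches \<open>s\<close> after at most \<open>f u\<close>
  steps. The bound on \<open>f\<close> along \<open>p\<close> is carried through the induction
  because it keeps the path simple: the new first vertex has a larger value.\<close>

lemma vpath_of_descent:
  fixes f :: "'a \<Rightarrow> nat"
  assumes "s \<in> pverts G"
    and arcs: "\<And>u v. (u, v) \<in> parcs G \<Longrightarrow> u \<in> pverts G \<and> v \<in> pverts G"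
    and descent: "\<And>u. u \<in> pverts G \<Longrightarrow> u \<noteq> s \<Longrightarrow> \<exists>w. (u, w) \<in> parcs G \<and> f w < f u"
    and "u \<in> pverts G"
  shows "\<exists>p. vpath p (with_proj G) \<and> hd p = u \<and> last p = s \<and> length p \<le> f u + 1 \<and>
           (\<forall>x \<in> set p. f x \<le> f u)"
  using assms(4)
proof (induction "f u" arbitrary: u rule: less_induct)
  case less
  show ?case
  proof (cases "u = s")
    case True
    with assms(1) show ?thesis by (intro exI[of _ "[s]"]) (auto intro: vpath_self)
  next
    case False
    then obtain w where w: "(u, w) \<in> parcs G" "f w < f u" using descent less.prems by blast
    then obtain p where p: "vpath p (with_proj G)" "hd p = w" "last p = s" "length p \<le> f w + 1"
        "\<forall>x \<in> set p. f x \<le> f w"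
      using less.hyps arcs by blast
    have ne: "p \<noteq> []" using p(1) by auto
    have "u \<notin> set p" using p(5) w(2) by auto
    moreover have "vwalk (u # p) (with_proj G)"
      using p w less.prems by (intro vwalk_consI) auto
    ultimately have "vpath (u # p) (with_proj G)" using p(1) by (simp add: vpath_def)
    then show ?thesis
      using p w ne by (intro exI[of _ "u # p"]) force
  qed
qed

text \<open>The hypotheses force \<open>f\<close> to be the distance to \<open>s\<close>.\<close>

lemma zombie_move_decreases:
  fixes f :: "'a \<Rightarrow> nat"
  assumes "s \<in> pverts G" and "f s = 0"
    and loopfree: "\<And>u. (u, u) \<notin> parcs G"
    and arcs: "\<And>u v. (u, v) \<in> parcs G \<Longrightarrow> u \<in> pverts G \<and> v \<in> pverts G"
    and lip: "\<And>u v. (u, v) \<in> parcs G \<Longrightarrow> f u \<le> f v + 1"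
    and descent: "\<And>u. u \<in> pverts G \<Longrightarrow> u \<noteq> s \<Longrightarrow> \<exists>w. (u, w) \<in> parcs G \<and> f w < f u"
    and "zombie_move G s u w"
  shows "f w < f u"
proof -
  obtain p where uw: "(u, w) \<in> parcs G" and p: "shortest_path G u p s" "w \<in> set p"
    using assms(7) by (auto simp: zombie_move_def)
  obtain q where q: "vpath q (with_proj G)" "hd q = u" "last q = s" "length q \<le> f u + 1"
    using vpath_of_descent[of s G f u] assms(1) arcs descent uw by blast
  have walk: "vwalk p (with_proj G)" and hd: "hd p = u" and last: "last p = s"
    and len: "length p - 1 \<le> length q - 1"
    using p(1) q by (auto simp: shortest_path_def)
  obtain ys zs where split: "p = ys @ w # zs" using p(2) by (meson split_list)
  \<comment> \<open>A zombie cannot stay put, so \<open>w\<close> is not the first vertex of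
    \<open>p\<close>, and fewer than \<open>f u\<close> arcs of \<open>p\<close> remain after
    it.\<close>
  have "ys \<noteq> []" using split hd uw loopfree by auto
  moreover have "vwalk (w # zs) (with_proj G)" using walk split vwalkI_append_r by blast
  then have "f w \<le> length zs"
    using vwalk_potential_le[of "w # zs" G f] lip last assms(2) split by auto
  ultimately show ?thesis using len q(4) split by (cases ys) auto
qed

text \<open>Descent leads from every vertex to \<open>s\<close>, and in the symmetric closure the
  same arcs lead back.\<close>

lemma connected_of_descent:
  fixes f :: "'a \<Rightarrow> nat"
  assumes "s \<in> pverts G"
    and arcs: "\<And>u v. (u, v) \<in> parcs G \<Longrightarrow> u \<in> pverts G \<and> v \<in> pverts G"
    and descent: "\<And>u. u \<in> pverts G \<Longrightarrow> u \<noteq> s \<Longrightarrow> \<exists>w. (u, w) \<in> parcs G \<and> f w < f u"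
  shows "Digraph_Component.connected (with_proj G)"
proof -
  let ?R = "rtrancl_on (pverts G) ((parcs G)\<^sup>s)"
  have to: "(u, s) \<in> ?R \<and> (s, u) \<in> ?R" if "u \<in> pverts G" for u
    using that
  proof (induction "f u" arbitrary: u rule: less_induct)
    case less
    show ?case
    proof (cases "u = s")
      case True
      with assms(1) show ?thesis by simp
    next
      case False
      then obtain w where w: "(u, w) \<in> parcs G" "f w < f u" using descent less.prems by blast
      then have "(w, s) \<in> ?R" "(s, w) \<in> ?R" using less.hyps arcs by blast+
      moreover have "(u, w) \<in> (parcs G)\<^sup>s" "(w, u) \<in> (parcs G)\<^sup>s"
        using w by (auto simp: symcl_def)
      ultimately show ?thesis
        using w arcs by (meson converse_rtrancl_on_into_rtrancl_on rtrancl_on_into_rtrancl_on)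
    qed
  qed
  then show ?thesis
    using assms(1) by (auto simp: connected_conv intro: rtrancl_on_trans)
qed

text \<open>Against a walk fixed in advance zombies do not influence one another, so it suffices to
  track one: \<open>I n\<close> contains its possible positions at the end of round
  \<open>n\<close>. Capture by a zombie is excluded by \<open>w \<noteq> \<sigma> n\<close>, running
  into one by \<open>safe\<close>.\<close>

lemma survivor_winning_strategy_oblivious:
  fixes \<sigma> :: "nat \<Rightarrow> 'a" and I :: "nat \<Rightarrow> 'a set"
  assumes "set Z\<^sub>0 \<subseteq> I 0" and "\<sigma> 0 \<in> pverts G"
    and safe: "\<And>n. \<sigma> n \<notin> I n"
    and move: "\<And>n. survivor_move G (\<sigma> n) (\<sigma> (Suc n))"
    and inv: "\<And>n u w. u \<in> I n \<Longrightarrow> zombie_move G (\<sigma> n) u w \<Longrightarrow> w \<in> I (Suc n) \<and> w \<noteq> \<sigma> n"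
  shows "survivor_winning_strategy G Z\<^sub>0 (\<lambda>h Z. \<sigma> (length h))"
proof -
  let ?\<tau> = "\<lambda>(h :: 'a history) (Z :: 'a list). \<sigma> (length h)"
  have step: "set Z \<subseteq> I (length h) \<and> \<not> caught_by_zombies h Z"
    if "legal_zombies G m h Z" "h = [] \<longrightarrow> Z = Z\<^sub>0"
      "h \<noteq> [] \<longrightarrow> set (fst (last h)) \<subseteq> I (length h - 1) \<and> snd (last h) = \<sigma> (length h - 1)"
    for m h Z
  proof (cases "h = []")
    case True
    with that assms(1) show ?thesis by (simp add: caught_by_zombies_def)
  next
    case False
    then obtain n where n: "length h = Suc n" by (cases h) auto
    have "list_all2 (zombie_move G (\<sigma> n)) (fst (last h)) Z"
      using that False n by (simp add: legal_zombies_def)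
    then have "\<exists>u \<in> set (fst (last h)). zombie_move G (\<sigma> n) u w" if "w \<in> set Z" for w
      using that by (metis in_set_conv_nth list_all2_conv_all_nth)
    then have "w \<in> I (Suc n) \<and> w \<noteq> \<sigma> n" if "w \<in> set Z" for w
      using that inv \<open>h \<noteq> [] \<longrightarrow> _\<close> False n by fastforce
    then show ?thesis using that False n by (auto simp: caught_by_zombies_def)
  qed
  have last: "set (fst (last h)) \<subseteq> I (length h - 1) \<and> snd (last h) = \<sigma> (length h - 1)"
    if "ongoing G m h" "follows_survivor ?\<tau> h" "h \<noteq> []" "fst (hd h) = Z\<^sub>0" for m h
    using that
  proof (induction rule: ongoing.induct)
    case start
    then show ?case by simp
  next
    case (round h Z s)
    have "follows_survivor ?\<tau> h"
      unfolding follows_survivor_def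
    proof (intro allI impI)
      fix n assume "n < length h"
      then show "snd (h ! n) = \<sigma> (length (take n h))"
        using round.prems(1) unfolding follows_survivor_def
        by (auto simp: nth_append dest!: spec[of _ n])
    qed
    then have "h \<noteq> [] \<longrightarrow> set (fst (last h)) \<subseteq> I (length h - 1) \<and> snd (last h) = \<sigma> (length h - 1)"
      using round by auto
    moreover have "h = [] \<longrightarrow> Z = Z\<^sub>0" using round.prems by auto
    ultimately have "set Z \<subseteq> I (length h)"
      using step round.hyps by blast
    moreover have "s = \<sigma> (length h)"
      using round.prems(1) by (auto simp: follows_survivor_def dest!: spec[of _ "length h"])
    ultimately show ?case by simp
  qed
  show ?thesis
    unfolding survivor_winning_strategy_def
  proof (intro allI impI, elim conjE)
    fix h Z
    assume *: "ongoing G (length Z\<^sub>0) h" "follows_survivor ?\<tau> h" "h \<noteq> [] \<longrightarrow> fst (hd h) = Z\<^sub>0"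
      "legal_zombies G (length Z\<^sub>0) h Z" "h = [] \<longrightarrow> Z = Z\<^sub>0"
    then have prev: "h \<noteq> [] \<longrightarrow>
        set (fst (last h)) \<subseteq> I (length h - 1) \<and> snd (last h) = \<sigma> (length h - 1)"
      using last by blast
    have "legal_survivor G h (\<sigma> (length h))"
      using prev assms(2) move[of "length h - 1"] by (auto simp: legal_survivor_def)
    then show "\<not> caught_by_zombies h Z \<and> legal_survivor G h (\<sigma> (length h)) \<and> \<sigma> (length h) \<notin> set Z"
      using step[OF *(4,5) prev] safe by blast
  qed
qed

text \<open>The survivor answers the placement \<open>\<sigma> []\<close> with a strategy chosen for
  it. The two strategies played against each other give an infinite play, which a winning zombie
  strategy forbids.\<close>

lemma no_zombie_winning_strategy:
  assumes surv: "\<And>Z\<^sub>0. set Z\<^sub>0 \<subseteq> pverts G \<Longrightarrow> length Z\<^sub>0 = m \<Longrightarrow>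
      \<exists>\<tau>. survivor_winning_strategy G Z\<^sub>0 \<tau>"
  shows "\<not> zombie_winning_strategy G m \<sigma>"
proof
  assume win: "zombie_winning_strategy G m \<sigma>"
  have legal: "legal_zombies G m h (\<sigma> h)" if "ongoing G m h" "follows_zombies \<sigma> h" for h
    using win that by (simp add: zombie_winning_strategy_def)
  have "legal_zombies G m [] (\<sigma> [])"
    by (intro legal ongoing.start) (simp add: follows_zombies_def)
  then have len: "length (\<sigma> []) = m" and "set (\<sigma> []) \<subseteq> pverts G"
    by (auto simp: legal_zombies_def)
  then obtain \<tau> where \<tau>: "survivor_winning_strategy G (\<sigma> []) \<tau>" using surv by blast
  define H where "H = rec_nat [] (\<lambda>_ h. h @ [(\<sigma> h, \<tau> h (\<sigma> h))])"
  have H0: "H 0 = []" and HS: "H (Suc n) = H n @ [(\<sigma> (H n), \<tau> (H n) (\<sigma> (H n)))]" for n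
    by (simp_all add: H_def)
  define r where "r n = (\<sigma> (H n), \<tau> (H n) (\<sigma> (H n)))" for n
  have Hr: "H n = map r [0..<n]" for n
    by (induction n) (simp_all add: H0 HS r_def)
  have fz: "follows_zombies \<sigma> (H n)" and fs: "follows_survivor \<tau> (H n)" for n
    unfolding follows_zombies_def follows_survivor_def
    by (auto simp: Hr r_def take_map)
  have "ongoing G m (H n)" for n
  proof (induction n)
    case 0
    then show ?case by (simp add: H0 ongoing.start)
  next
    case (Suc n)
    have "H n \<noteq> [] \<longrightarrow> fst (hd (H n)) = \<sigma> []" "H n = [] \<longrightarrow> \<sigma> (H n) = \<sigma> []"
      by (auto simp: Hr hd_map r_def H0[unfolded Hr])
    then have "\<not> caught_by_zombies (H n) (\<sigma> (H n)) \<and> legal_survivor G (H n) (\<tau> (H n) (\<sigma> (H n))) \<and>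
        \<tau> (H n) (\<sigma> (H n)) \<notin> set (\<sigma> (H n))"
      using \<tau> Suc fs legal[OF Suc fz] len unfolding survivor_winning_strategy_def by blast
    then show ?case unfolding HS using Suc legal[OF Suc fz] by (blast intro: ongoing.round)
  qed
  then show False using win fz unfolding zombie_winning_strategy_def Hr by blast
qed

section \<open>The chase in the Petersen graph\<close>

text \<open>The outer 5-cycle is \<open>0, 1, 2, 3, 4\<close>, and \<open>x\<close> is joined to \<open>x + 5\<close> by a spoke.\<close>

definition petersen :: "nat \<Rightarrow> nat \<Rightarrow> bool" where
  "petersen x y \<longleftrightarrow> (let E = {(0,1), (1,2), (2,3), (3,4), (4,0), (0,5), (1,6), (2,7), (3,8), (4,9),
     (5,7), (7,9), (9,6), (6,8), (8,5)} in (x, y) \<in> E \<or> (y, x) \<in> E)"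

text \<open>The Petersen graph has diameter 2, so this is its distance on vertices below 10.\<close>

definition pdist :: "nat \<Rightarrow> nat \<Rightarrow> nat" where
  "pdist x y = (if x = y then 0 else if petersen x y then 1 else 2)"

lemma petersen_sym: "petersen x y \<Longrightarrow> petersen y x"
  by (auto simp: petersen_def Let_def)

lemma petersen_less: "petersen x y \<Longrightarrow> x < 10 \<and> y < 10"
  by (auto simp: petersen_def Let_def)

lemma petersen_irrefl: "\<not> petersen x x"
  by (auto simp: petersen_def Let_def)

lemma pdist_le_Suc: "petersen x y \<Longrightarrow> pdist x z \<le> pdist y z + 1"
  by (auto simp: pdist_def)

lemma pdist_eq_0_iff [simp]: "pdist x y = 0 \<longleftrightarrow> x = y"
  by (simp add: pdist_def)

lemma pdist_le_2: "pdist x y \<le> 2"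
  by (simp add: pdist_def)

lemma pdist_descent:
  assumes "x < 10" "z < 10" "x \<noteq> z"
  shows "\<exists>y. petersen x y \<and> pdist y z < pdist x z"
proof -
  have "x \<in> {0,1,2,3,4,5,6,7,8,9}" "z \<in> {0,1,2,3,4,5,6,7,8,9}"
    using assms unfolding insert_iff empty_iff by presburger+
  then show ?thesis
    using assms(3)
    by (elim insertE emptyE)
      (simp_all add: petersen_def Let_def pdist_def conj_disj_distribR ex_disj_distrib)
qed

text \<open>The prefix 1, 2, 3, 8, 6 gathers the zombies: from both 3 and 5 the only geodesic to 6
  goes through 8. Then the spoke from 6 to 1 leads to the outer 5-cycle.\<close>

definition escape :: "nat \<Rightarrow> nat" where
  "escape t = (if t < 5 then [1, 2, 3, 8, 6] ! t else [1, 0, 4, 3, 2] ! (t mod 5))"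

text \<open>
  The possible positions at the end of round \<open>t\<close> of zombies that entered through \<open>0\<close> in one of the
  rounds 1, 2, 3.
\<close>

definition pursuers :: "nat \<Rightarrow> nat set" where
  "pursuers t = (if t < 5 then [{}, {0}, {0, 1}, {0, 2, 4}, {3, 5}] ! t else {escape (t - 2)})"

lemma escape_periodic: "t \<ge> 5 \<Longrightarrow> escape (t + 5) = escape t"
  by (simp add: escape_def)

lemma pursuers_periodic:
  assumes "t \<ge> 7"
  shows "pursuers (t + 5) = pursuers t"
proof -
  have "t + 5 - 2 = (t - 2) + 5" using assms by simp
  then show ?thesis using assms escape_periodic[of "t - 2"] by (simp add: pursuers_def)
qed

lemma chase:
  "escape t < 10 \<and> petersen (escape t) (escape (Suc t)) \<and> escape t \<notin> pursuers t \<and>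
   (\<forall>x \<in> pursuers t. x < 10 \<and> (\<forall>y. petersen x y \<longrightarrow> pdist y (escape t) < pdist x (escape t) \<longrightarrow>
      y \<in> pursuers (Suc t) \<and> y \<noteq> escape t))"
proof (induction t rule: less_induct)
  case (less t)
  show ?case
  \<comment> \<open>The cycle starts in round 5 and the zombies lag two rounds behind, so both
    functions have period 5 from round 7 on; evaluating the rounds before 7 + 5 is enough.\<close>
  proof (cases "t < 12")
    case True
    then have "t \<in> {0,1,2,3,4,5,6,7,8,9,10,11}"
      unfolding insert_iff empty_iff by presburger
    then show ?thesis
      by (elim insertE emptyE)
        (auto simp: escape_def pursuers_def petersen_def Let_def pdist_def)
  next
    case False
    then have "t = (t - 5) + 5" "t - 5 \<ge> 7" by simp_all
    then obtain t' where t': "t = t' + 5" "t' \<ge> 7" by blast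
    have "escape t = escape t'" "pursuers t = pursuers t'"
      "escape (Suc t) = escape (Suc t')" "pursuers (Suc t) = pursuers (Suc t')"
      using t' escape_periodic[of t'] escape_periodic[of "Suc t'"]
        pursuers_periodic[of t'] pursuers_periodic[of "Suc t'"] by simp_all
    then show ?thesis using less.IH[of t'] t' by simp
  qed
qed

text \<open>For zombies arriving from outside: one on the clique after round \<open>t\<close> steps
  onto the root in the next round, which must be an allowed position and not the survivor's
  vertex.\<close>

lemma chase_entry:
  assumes "t \<le> 2"
  shows "0 \<in> pursuers (Suc t)" "escape t \<noteq> 0"
proof -
  have "t = 0 \<or> t = 1 \<or> t = 2" using assms by auto
  then show "0 \<in> pursuers (Suc t)" "escape t \<noteq> 0" by (auto simp: pursuers_def escape_def)
qed

section \<open>Petersen graphs attached to a clique\<close>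

text \<open>
  The vertices \<open>10 * i, \<dots>, 10 * i + 9\<close> with \<open>i < k\<close> form the \<open>i\<close>-th Petersen graph; depth is the
  distance to the clique.
\<close>

definition depth :: "nat \<Rightarrow> nat \<Rightarrow> nat" where
  "depth k v = (if v < 10 * k then pdist (v mod 10) 0 else 0)"

definition zgraph :: "nat \<Rightarrow> nat pair_pre_digraph" where
  "zgraph k = \<lparr>pverts = {..<15 * k},
     parcs = {(u, v). u < 15 * k \<and> v < 15 * k \<and> u \<noteq> v \<and>
       (depth k u = 0 \<and> depth k v = 0 \<or>
        u < 10 * k \<and> v < 10 * k \<and> u div 10 = v div 10 \<and> petersen (u mod 10) (v mod 10))}\<rparr>"

text \<open>The distance from \<open>v\<close> to \<open>10 * i + s\<close>: from outside copy
  \<open>i\<close> the way leads to the clique, over one clique arc to the root of the copy, and on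
  to \<open>s\<close>.\<close>

definition zdist :: "nat \<Rightarrow> nat \<Rightarrow> nat \<Rightarrow> nat \<Rightarrow> nat" where
  "zdist k i s v = (if v div 10 = i then pdist (v mod 10) s else depth k v + 1 + pdist 0 s)"

lemma pverts_zgraph [simp]: "pverts (zgraph k) = {..<15 * k}"
  by (simp add: zgraph_def)

lemma zgraph_arc_cases:
  assumes "(u, v) \<in> parcs (zgraph k)"
  obtains (clique) "u < 15 * k" "v < 15 * k" "u \<noteq> v" "depth k u = 0" "depth k v = 0"
  | (petersen) "u < 10 * k" "v < 10 * k" "u div 10 = v div 10" "petersen (u mod 10) (v mod 10)"
  using assms by (auto simp: zgraph_def)

lemma zgraph_petersen_arc:
  assumes "u < 10 * k" "petersen (u mod 10) y"
  shows "(u, 10 * (u div 10) + y) \<in> parcs (zgraph k)"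
proof -
  have "y < 10" "y \<noteq> u mod 10" using assms petersen_less petersen_irrefl by auto
  moreover have "10 * (u div 10) + y < 10 * k" using assms(1) \<open>y < 10\<close> by presburger
  moreover have "10 * (u div 10) + y \<noteq> u" using \<open>y \<noteq> u mod 10\<close> by presburger
  ultimately show ?thesis using assms by (auto simp: zgraph_def)
qed

lemma pair_graph_zgraph: "pair_graph (zgraph k)"
proof -
  have "parcs (zgraph k) \<subseteq> {..<15 * k} \<times> {..<15 * k}" by (auto simp: zgraph_def)
  then have "finite (parcs (zgraph k))" by (rule finite_subset) simp
  moreover have "Digraph.symmetric (with_proj (zgraph k))"
    unfolding symmetric_def by (rule symI) (auto simp: zgraph_def petersen_sym)
  ultimately show ?thesis
    by unfold_locales (auto simp: zgraph_def)
qed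

text \<open>The root is thus the only gate of its copy.\<close>

lemma clique_vertex_in_copy:
  assumes "depth k v = 0" "v div 10 = i" "i < k"
  shows "v = 10 * i"
proof -
  have "v < 10 * k" using assms by linarith
  with assms have "v mod 10 = 0" by (simp add: depth_def)
  with assms(2) show ?thesis by presburger
qed

text \<open>Together with \<open>zdist_descent\<close> this certifies \<open>zdist\<close> as the
  distance.\<close>

lemma zdist_le_Suc:
  assumes "(u, v) \<in> parcs (zgraph k)" "i < k"
  shows "zdist k i s u \<le> zdist k i s v + 1"
  using assms(1)
proof (cases rule: zgraph_arc_cases)
  case clique
  then have "u div 10 = i \<Longrightarrow> u = 10 * i" "v div 10 = i \<Longrightarrow> v = 10 * i"
    using clique_vertex_in_copy assms(2) by blast+
  then show ?thesis
    using clique by (cases "u div 10 = i"; cases "v div 10 = i") (simp_all add: zdist_def)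
next
  case petersen
  then show ?thesis
    using pdist_le_Suc[OF petersen(4)] by (auto simp: zdist_def depth_def)
qed

lemma zdist_descent:
  assumes "i < k" "s < 10" "u < 15 * k" "u \<noteq> 10 * i + s"
  shows "\<exists>w. (u, w) \<in> parcs (zgraph k) \<and> zdist k i s w < zdist k i s u"
proof -
  \<comment> \<open>The descending step goes towards \<open>s\<close> inside copy \<open>i\<close>,
    from the clique to the root \<open>10 * i\<close>, and in another copy towards that copy's
    root.\<close>
  consider "u div 10 = i" | "u div 10 \<noteq> i" "depth k u = 0" | "u div 10 \<noteq> i" "depth k u \<noteq> 0"
    by blast
  then show ?thesis
  proof cases
    case 1
    then have "u < 10 * k" "u mod 10 \<noteq> s" using assms by (linarith, presburger)
    then obtain y where y: "petersen (u mod 10) y" "pdist y s < pdist (u mod 10) s"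
      using pdist_descent[of "u mod 10" s] assms(2) by auto
    have "y < 10" using y petersen_less by blast
    then show ?thesis
      using y 1 zgraph_petersen_arc[OF \<open>u < 10 * k\<close> y(1)]
      by (intro exI[of _ "10 * (u div 10) + y"]) (simp add: zdist_def)
  next
    case 2
    then show ?thesis
      using assms by (intro exI[of _ "10 * i"]) (auto simp: zdist_def zgraph_def depth_def)
  next
    case 3
    then have "u < 10 * k" "u mod 10 \<noteq> 0" unfolding depth_def by (metis pdist_eq_0_iff)+
    then obtain y where y: "petersen (u mod 10) y" "pdist y 0 < pdist (u mod 10) 0"
      using pdist_descent[of "u mod 10" 0] by auto
    have "y < 10" using y petersen_less by blast
    moreover have "10 * (u div 10) + y < 10 * k" using \<open>u < 10 * k\<close> \<open>y < 10\<close> by presburger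
    ultimately show ?thesis
      using y 3 \<open>u < 10 * k\<close> zgraph_petersen_arc[OF \<open>u < 10 * k\<close> y(1)]
      by (intro exI[of _ "10 * (u div 10) + y"]) (simp add: zdist_def depth_def)
  qed
qed

lemma zgraph_arc_verts: "(u, v) \<in> parcs (zgraph k) \<Longrightarrow> u \<in> pverts (zgraph k) \<and> v \<in> pverts (zgraph k)"
  by (auto simp: zgraph_def)

lemma zombie_move_zdist:
  assumes "i < k" "s < 10" "zombie_move (zgraph k) (10 * i + s) u w"
  shows "(u, w) \<in> parcs (zgraph k)" "zdist k i s w < zdist k i s u"
proof -
  show "(u, w) \<in> parcs (zgraph k)" using assms(3) by (simp add: zombie_move_def)
  show "zdist k i s w < zdist k i s u"
    using _ _ _ zgraph_arc_verts zdist_le_Suc[OF _ assms(1)] zdist_descent[OF assms(1,2)] assms(3)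
  proof (rule zombie_move_decreases)
    show "10 * i + s \<in> pverts (zgraph k)" using assms(1,2) by simp
    show "zdist k i s (10 * i + s) = 0" using assms(2) by (simp add: zdist_def)
    show "(u, u) \<notin> parcs (zgraph k)" for u by (simp add: zgraph_def)
  qed simp_all
qed

lemma connected_zgraph:
  assumes "k > 0"
  shows "Digraph_Component.connected (with_proj (zgraph k))"
  by (rule connected_of_descent[where s = 0 and f = "zdist k 0 0"])
    (use assms zgraph_arc_verts zdist_descent[of 0 k 0] in auto)

text \<open>Outside copy \<open>i\<close> a zombie starts at depth at most 2 and loses depth in
  every round until it enters, so it enters by round 3. The bound is a sum because truncated
  subtraction would allow depth 0 forever.\<close>

definition zombie_area :: "nat \<Rightarrow> nat \<Rightarrow> nat \<Rightarrow> nat set" where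
  "zombie_area k i t = {v. v < 15 * k \<and>
     (if v div 10 = i then v mod 10 \<in> pursuers t else depth k v + t \<le> 2)}"

lemma zombie_area_step:
  assumes "i < k" "u \<in> zombie_area k i t" "zombie_move (zgraph k) (10 * i + escape t) u w"
  shows "w \<in> zombie_area k i (Suc t) \<and> w \<noteq> 10 * i + escape t"
proof -
  let ?s = "escape t"
  have s: "?s < 10" using chase by blast
  have arc: "(u, w) \<in> parcs (zgraph k)" and less: "zdist k i ?s w < zdist k i ?s u"
    using zombie_move_zdist[OF assms(1) s assms(3)] by auto
  have w: "w < 15 * k" using zgraph_arc_verts[OF arc] by simp
  show ?thesis
  proof (cases "u div 10 = i")
    case True
    with assms(2) have u: "u mod 10 \<in> pursuers t" by (simp add: zombie_area_def)
    from arc show ?thesis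
    proof (cases rule: zgraph_arc_cases)
      case clique
      then have "u = 10 * i" "w div 10 \<noteq> i"
        using clique_vertex_in_copy[of k u i] clique_vertex_in_copy[of k w i] True assms(1) by auto
      \<comment> \<open>Leaving through the root leads away from the survivor, contradicting
        \<open>less\<close>.\<close>
      with less show ?thesis by (simp add: zdist_def)
    next
      case petersen
      then have "pdist (w mod 10) ?s < pdist (u mod 10) ?s" using less True by (simp add: zdist_def)
      then have "w mod 10 \<in> pursuers (Suc t) \<and> w mod 10 \<noteq> ?s"
        using chase[of t] u petersen by auto
      moreover from this have "w \<noteq> 10 * i + ?s" using s by auto
      ultimately show ?thesis using w petersen True by (simp add: zombie_area_def)
    qed
  next
    case False
    with assms(2) have u: "depth k u + t \<le> 2" by (simp add: zombie_area_def)
    show ?thesis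
    proof (cases "w div 10 = i")
      case True
      \<comment> \<open>Only clique arcs cross the border of the copy, so entry is at the
        root.\<close>
      with arc False have "depth k u = 0" "depth k w = 0"
        by (auto elim: zgraph_arc_cases)
      then have "w = 10 * i" using True assms(1) clique_vertex_in_copy by blast
      then show ?thesis
        using w chase_entry[of t] u by (auto simp: zombie_area_def)
    next
      case outside: False
      then have "depth k w < depth k u" using less False by (simp add: zdist_def)
      then show ?thesis using u w outside s by (auto simp: zombie_area_def)
    qed
  qed
qed

lemma survivor_wins_zgraph:
  assumes "set Z\<^sub>0 \<subseteq> pverts (zgraph k)" "length Z\<^sub>0 < k"
  shows "\<exists>\<tau>. survivor_winning_strategy (zgraph k) Z\<^sub>0 \<tau>"
proof -
  \<comment> \<open>Pigeonhole: fewer than \<open>k\<close> zombies cannot occupy all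
    \<open>k\<close> copies.\<close>
  have "card ((\<lambda>v. v div 10) ` set Z\<^sub>0) < card {..<k}"
    using assms(2) card_image_le[of "set Z\<^sub>0" "\<lambda>v. v div 10"] card_length[of Z\<^sub>0] by simp
  then have "\<not> {..<k} \<subseteq> (\<lambda>v. v div 10) ` set Z\<^sub>0"
    by (metis List.finite_set card_mono finite_imageI not_le)
  then obtain i where i: "i < k" "\<And>z. z \<in> set Z\<^sub>0 \<Longrightarrow> z div 10 \<noteq> i" by auto
  have "survivor_winning_strategy (zgraph k) Z\<^sub>0 (\<lambda>h Z. 10 * i + escape (length h))"
  proof (rule survivor_winning_strategy_oblivious[where I = "zombie_area k i"])
    show "set Z\<^sub>0 \<subseteq> zombie_area k i 0"
      using assms(1) i pdist_le_2 by (auto simp: zombie_area_def depth_def)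
    show "10 * i + escape 0 \<in> pverts (zgraph k)"
      using i(1) by (simp add: escape_def)
    show "10 * i + escape n \<notin> zombie_area k i n" for n
      using chase[of n] by (auto simp: zombie_area_def)
    show "survivor_move (zgraph k) (10 * i + escape n) (10 * i + escape (Suc n))" for n
    proof -
      have e: "escape n < 10" "petersen (escape n) (escape (Suc n))" using chase[of n] by auto
      then show ?thesis
        using zgraph_petersen_arc[of "10 * i + escape n" k "escape (Suc n)"] i(1)
        by (simp add: survivor_move_def)
    qed
  qed (use zombie_area_step[OF i(1)] in blast)+
  then show ?thesis by blast
qed

theorem theorem3:
  fixes k :: nat
  assumes "k \<ge> 2"
  shows "\<exists>G :: nat pair_pre_digraph.
           pair_graph G \<and> Digraph_Component.connected (with_proj G) \<and> card (pverts G) = 15 * k \<and>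
           zombie_number G \<ge> k \<and>
           (\<forall>Z\<^sub>0. set Z\<^sub>0 \<subseteq> pverts G \<and> length Z\<^sub>0 \<le> k - 1 \<longrightarrow>
              (\<exists>\<tau>. survivor_winning_strategy G Z\<^sub>0 \<tau>))"
proof (intro exI[of _ "zgraph k"] conjI allI impI)
  \<comment> \<open>The minimum is attained, so a value below \<open>k\<close> would give a winning
    strategy for that many zombies.\<close>
  have "\<exists>\<sigma>. zombie_winning_strategy (zgraph k) (zombie_number (zgraph k)) \<sigma>"
    unfolding zombie_number_def
    by (rule LeastI_ex) (use zombie_winning_strategy_card[of "zgraph k"] in auto)
  then show "zombie_number (zgraph k) \<ge> k"
    using no_zombie_winning_strategy survivor_wins_zgraph by (metis not_le)
qed (use assms pair_graph_zgraph connected_zgraph survivor_wins_zgraph in auto)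

end
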